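(* Let $R$ be a (commutative) projective-free ring, let $n\ge 1$, and let $h\in R[t]$ be a monic polynomial of degree $n$. Then the following are equivalent: (1) Every matrix $\varphi\in M_n(R)$ with characteristic polynomial $\chi(\varphi)=h$ is strongly clean in $M_n(R)$. (2) The companion matrix $C_h\in M_n(R)$ of $h$ is strongly clean in $M_n(R)$. (3) There exists a factorization $h=h_0h_1$ in $R[t]$ such that $h_0\in\mathbb{S}_0$, $h_1\in\mathbb{S}_1$ and $(h_0,h_1)=1$.
   Context: Rings have an identity. A commutative ring $R$ is projective-free if every finitely generated projective $R$-module is free. An element $a$ of a (not necessarily commutative) ring $S$ is strongly clean if there are an idempotent $e\in S$ and a unit $u\in S$ with $a=e+u$ and $eu=ue$. $M_n(R)$ is the ring of $n\times n$ matrices over $R$, and $U(R)$ is the set of invertible elements of $R$. $\chi(\varphi)=\det(tI_n-\varphi)\in R[t]$ is the characteristic polynomial of $\varphi$. For $h=t^n+a_{n-1}t^{n-1}+\cdots+a_1t+a_0$, the companion matrix is $$C_h=\left(\begin{array}{ccccc}0&0&\cdots&0&-a_0\\1&0&\cdots&0&-a_1\\\vdots&\vdots&\ddots&\vdots&\vdots\\0&0&\cdots&1&-a_{n-1}\end{array}\right)\in M_n(R).$$ For $r\in R$, $\mathbb{S}_r=\{f\in R[t] : f \text{ is monic and } f(r)\in U(R)\}$ (the constant polynomial $1$ counts as monic of degree $0$). For $f,g\in R[t]$, the notation $(f,g)=1$ means that there exist $u,v\in R[t]$ with $fu+gv=1$. *)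

theory Defs
  imports "Jordan_Normal_Form.Char_Poly" "Jordan_Normal_Form.VS_Connect"
begin

definition strongly_clean :: "('a, 'b) ring_scheme \<Rightarrow> 'a \<Rightarrow> bool" where
  "strongly_clean S a \<longleftrightarrow>
     (\<exists>e \<in> carrier S. \<exists>u \<in> Units S.
        e \<otimes>\<^bsub>S\<^esub> e = e \<and> a = e \<oplus>\<^bsub>S\<^esub> u \<and> e \<otimes>\<^bsub>S\<^esub> u = u \<otimes>\<^bsub>S\<^esub> e)"

text \<open>
  A quantifier over all modules would have to range over types, so the carriers are taken in the
  type \<^typ>\<open>'a vec\<close> of all finite vectors over the type of the ring elements. This loses nothing:
  sending an element to the coefficients of a chosen presentation by a finite generating set
  embeds every finitely generated module into \<^typ>\<open>'a vec\<close>, so every finitely generated module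
  is isomorphic to one considered here.

  The same type suffices for the modules against which projectivity is tested. A module \<open>M\<close> with
  carrier in \<^typ>\<open>'a vec\<close> is a quotient of the free module on its elements, which has no more
  elements than \<^typ>\<open>'a vec\<close>; if the identity of \<open>M\<close> lifts along this quotient map, then \<open>M\<close>
  is a direct summand of a free module and so has the lifting property for modules of any size.
\<close>

definition finitely_generated_module :: "'a ring \<Rightarrow> ('a, 'm) module \<Rightarrow> bool" where
  "finitely_generated_module R M \<longleftrightarrow>
     module R M \<and>
     (\<exists>A. finite A \<and> A \<subseteq> carrier M \<and> LinearCombinations.module.gen_set R M A)"

definition free_module :: "'a ring \<Rightarrow> ('a, 'm) module \<Rightarrow> bool" where
  "free_module R M \<longleftrightarrow>
     module R M \<and>
     (\<exists>B \<subseteq> carrier M. LinearCombinations.module.lin_indpt R M B \<and>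
                      LinearCombinations.module.gen_set R M B)"

definition projective_module :: "'a ring \<Rightarrow> ('a, 'a vec) module \<Rightarrow> bool" where
  "projective_module R M \<longleftrightarrow>
     module R M \<and>
     (\<forall>(N :: ('a, 'a vec) module) (N' :: ('a, 'a vec) module) g f.
        module R N \<longrightarrow> module R N' \<longrightarrow>
        g \<in> module_hom R N N' \<longrightarrow> g ` carrier N = carrier N' \<longrightarrow>
        f \<in> module_hom R M N' \<longrightarrow>
        (\<exists>l \<in> module_hom R M N. \<forall>x \<in> carrier M. g (l x) = f x))"

definition projective_free :: "'a ring \<Rightarrow> bool" where
  "projective_free R \<longleftrightarrow>
     cring R \<and>
     (\<forall>M :: ('a, 'a vec) module.
        finitely_generated_module R M \<longrightarrow> projective_module R M \<longrightarrow> free_module R M)"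

text \<open>Rows and columns are indexed from \<open>0\<close>.\<close>

definition companion_matrix :: "'a :: comm_ring_1 poly \<Rightarrow> 'a mat" where
  "companion_matrix h =
     mat (degree h) (degree h)
       (\<lambda>(i, j). if j = degree h - 1 then - coeff h i else if i = j + 1 then 1 else 0)"

definition monic_unit_at :: "'a :: comm_ring_1 \<Rightarrow> 'a poly set" (\<open>\<S>\<close>) where
  "\<S> r = {f. monic f \<and> poly f r dvd 1}"

text \<open>Unlike \<^const>\<open>coprime\<close>, which only concerns common divisors.\<close>

definition comaximal :: "'a :: comm_ring_1 \<Rightarrow> 'a \<Rightarrow> bool" where
  "comaximal f g \<longleftrightarrow> (\<exists>u v. f * u + g * v = 1)"

end

theory Submission
  imports Defs
begin

text \<open>
  Let \<open>C\<close> be the companion matrix of the monic polynomial \<open>h\<close> of degree \<open>n\<close>. If all matrices with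
  characteristic polynomial \<open>h\<close> are strongly clean, then so is \<open>C\<close>, because the characteristic polynomial of \<open>C\<close> is \<open>h\<close> (\<open>char_poly_companion\<close>).

  A factorization makes all these matrices strongly clean: write \<open>h0 u + h1 v = 1\<close> and let \<open>A\<close> have characteristic polynomial \<open>h0 h1\<close>. By
  Cayley--Hamilton (\<open>cayley_hamilton\<close>) evaluation at \<open>A\<close> factors through \<open>R[t]/(h0 h1)\<close>, where
  \<open>p = h0 u\<close> is an idempotent. On the part where \<open>p = 1\<close>, \<open>h1\<close> vanishes, and since \<open>h1(1)\<close> is a unit
  and \<open>h1 \<equiv> h1(1)\<close> modulo \<open>t - 1\<close>, the element \<open>t - 1\<close> is a unit there; likewise \<open>t\<close> is a unit where
  \<open>p = 0\<close>. So \<open>t - p\<close> is a unit (\<open>comaximal_factors_give_inverse\<close>) and \<open>A = p(A) + (t - p)(A)\<close> is a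
  strongly clean decomposition.

  If \<open>C\<close> is strongly clean, a factorization exists; only this needs projective-freeness. Let \<open>C = e + u\<close> be a strongly clean
  decomposition and \<open>f = 1 - e\<close>. The images of \<open>e\<close> and \<open>f\<close> are finitely generated and projective,
  hence free (\<open>idempotent_splits\<close>), of ranks \<open>k\<close> and \<open>l\<close> with \<open>k + l \<le> n\<close>. Both are stable under
  \<open>C\<close>; let \<open>h1\<close> and \<open>h0\<close> be the characteristic polynomials of \<open>C\<close> on them. As \<open>C - 1 = u\<close> on the image
  of \<open>e\<close> and \<open>C = u\<close> on the image of \<open>f\<close>, the values \<open>h1(1)\<close> and \<open>h0(0)\<close> are units
  (\<open>char_poly_of_free_summand\<close>). Since \<open>C\<close> has a cyclic vector, \<open>q(C) = 0\<close> exactly when \<open>h\<close> divides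
  \<open>q\<close> (\<open>poly_mat_companion_eq_0_iff\<close>), and every matrix that commutes with \<open>C\<close> is a polynomial in \<open>C\<close>
  (\<open>commute_companion_obtains_poly\<close>). From \<open>h1(C) e = 0\<close> and \<open>h0(C) f = 0\<close> it follows that
  \<open>h\<close> divides \<open>h0 h1\<close>, whose degree is at most \<open>n\<close>, so \<open>h = h0 h1\<close>. Finally, if \<open>e = p(C)\<close>, then \<open>h0 h1\<close>
  divides both \<open>h1 p\<close> and \<open>h0 (1 - p)\<close>; cancelling monic factors, \<open>h0\<close> divides \<open>p\<close> and \<open>h1\<close> divides
  \<open>1 - p\<close>, so \<open>h0\<close> and \<open>h1\<close> are comaximal.
\<close>

section \<open>Monic polynomials over a commutative ring\<close>

lemma monic_division:
  fixes f h :: "'a :: comm_ring_1 poly"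
  assumes "monic h"
  obtains q r where "f = h * q + r" and "r = 0 \<or> degree r < degree h"
proof -
  have h0: "h \<noteq> 0" using assms by auto
  obtain q r where qr: "pseudo_divmod f h = (q, r)" by (cases "pseudo_divmod f h")
  from pseudo_divmod[OF h0 qr] assms that show ?thesis by simp
qed

lemma monic_mult_left_cancel:
  fixes f g h :: "'a :: comm_ring_1 poly"
  assumes "monic h" and "h * f = h * g"
  shows "f = g"
proof (rule ccontr)
  assume "f \<noteq> g"
  then have "f - g \<noteq> 0" by simp
  then have "lead_coeff (h * (f - g)) \<noteq> 0"
    unfolding lcoeff_monic_mult[OF assms(1), of "f - g", symmetric]
    by (metis lcoeff_monic_mult[OF assms(1)] \<open>f - g \<noteq> 0\<close> degree_monic_mult[OF assms(1)] leading_coeff_0_iff)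
  then show False using assms(2) by (simp add: right_diff_distrib)
qed

lemma monic_dvd_imp_eq:
  fixes f h :: "'a :: comm_ring_1 poly"
  assumes h: "monic h" and f: "monic f" and deg: "degree f \<le> degree h" and "h dvd f"
  shows "f = h"
proof -
  from \<open>h dvd f\<close> obtain q where q: "f = h * q" ..
  with f have "q \<noteq> 0" by auto
  from degree_monic_mult[OF h this] q deg have "degree q = 0" by simp
  moreover from lcoeff_monic_mult[OF h, of q] degree_monic_mult[OF h \<open>q \<noteq> 0\<close>] q f
  have "lead_coeff q = 1" by simp
  ultimately have "q = 1" by (metis degree_0_id one_pCons)
  with q show ?thesis by simp
qed

lemma poly_eq_value_plus_linear_multiple:
  fixes f :: "'a :: comm_ring_1 poly"
  obtains q where "f = [:poly f r:] + [:- r, 1:] * q"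
proof -
  have "[:- r, 1:] dvd f - [:poly f r:]" by (simp add: poly_eq_0_iff_dvd[symmetric])
  then obtain q where "f - [:poly f r:] = [:- r, 1:] * q" ..
  then have "f = [:poly f r:] + [:- r, 1:] * q" by (simp add: algebra_simps)
  then show ?thesis by (rule that)
qed

section \<open>Polynomials evaluated at square matrices\<close>

text \<open>
  The matrix \<open>p(A)\<close>, by Horner's scheme. The identity matrix is taken of size \<open>dim_row A\<close>; the
  definition is meaningful for square \<open>A\<close>.
\<close>

definition poly_mat :: "'a :: comm_ring_1 mat \<Rightarrow> 'a poly \<Rightarrow> 'a mat" where
  "poly_mat A p = fold_coeffs (\<lambda>a M. a \<cdot>\<^sub>m 1\<^sub>m (dim_row A) + A * M) p (0\<^sub>m (dim_row A) (dim_row A))"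

context
  fixes A :: "'a :: comm_ring_1 mat" and n :: nat
  assumes A [simp]: "A \<in> carrier_mat n n"
begin

lemmas [simp] = carrier_matD[OF A]

lemma poly_mat_0: "poly_mat A 0 = 0\<^sub>m n n"
  by (simp add: poly_mat_def)

lemma poly_mat_pCons:
  "poly_mat A (pCons a p) = a \<cdot>\<^sub>m 1\<^sub>m n + A * poly_mat A p"
proof (cases "a = 0 \<and> p = 0")
  case True
  then show ?thesis by (auto simp: poly_mat_def intro!: eq_matI)
next
  case False
  then show ?thesis by (auto simp: poly_mat_def)
qed

lemma poly_mat_carrier [simp]: "poly_mat A p \<in> carrier_mat n n"
  by (induction p) (auto simp: poly_mat_0 poly_mat_pCons)

lemmas [simp] = carrier_matD[OF poly_mat_carrier]

lemma poly_mat_const: "poly_mat A [:a:] = a \<cdot>\<^sub>m 1\<^sub>m n"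
  using right_mult_zero_mat[OF A, of n]
  by (auto simp: poly_mat_pCons poly_mat_0 intro!: eq_matI)

lemma poly_mat_1: "poly_mat A 1 = 1\<^sub>m n"
  unfolding one_pCons poly_mat_const by (auto intro!: eq_matI)

lemma poly_mat_X: "poly_mat A [:0, 1:] = A"
  unfolding poly_mat_pCons[of 0] poly_mat_const by (auto intro!: eq_matI)

lemma poly_mat_add: "poly_mat A (p + q) = poly_mat A p + poly_mat A q"
proof (induction p arbitrary: q)
  case 0
  show ?case by (simp add: poly_mat_0)
next
  case (pCons a p)
  show ?case
  proof (cases q)
    case (pCons b q')
    have "A * (poly_mat A p + poly_mat A q') = A * poly_mat A p + A * poly_mat A q'"
      by (rule mult_add_distrib_mat[of _ n n _ n]) auto
    with pCons.IH[of q'] pCons show ?thesis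
      by (auto simp: poly_mat_pCons algebra_simps intro!: eq_matI)
  qed
qed

lemma poly_mat_smult: "poly_mat A (Polynomial.smult c p) = c \<cdot>\<^sub>m poly_mat A p"
proof (induction p)
  case 0
  show ?case by (auto simp: poly_mat_0)
next
  case (pCons a p)
  have "A * (c \<cdot>\<^sub>m poly_mat A p) = c \<cdot>\<^sub>m (A * poly_mat A p)"
    by (rule mult_smult_distrib[of _ n n _ n]) auto
  with pCons.IH show ?case
    by (auto simp: poly_mat_pCons algebra_simps intro!: eq_matI)
qed

lemma poly_mat_mult: "poly_mat A (p * q) = poly_mat A p * poly_mat A q"
proof (induction p)
  case 0
  show ?case by (simp add: poly_mat_0 left_mult_zero_mat[of _ n n])
next
  case (pCons a p)
  have "poly_mat A (pCons a p * q) = a \<cdot>\<^sub>m poly_mat A q + A * (poly_mat A p * poly_mat A q)"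
    by (simp add: poly_mat_add poly_mat_smult poly_mat_pCons[of 0] pCons.IH)
      (auto intro!: eq_matI)
  also have "A * (poly_mat A p * poly_mat A q) = A * poly_mat A p * poly_mat A q"
    by (rule assoc_mult_mat[symmetric, of _ n n _ n _ n]) auto
  also have "a \<cdot>\<^sub>m poly_mat A q = (a \<cdot>\<^sub>m 1\<^sub>m n) * poly_mat A q"
    by (simp add: mult_smult_assoc_mat[of _ n n _ n])
  also have "(a \<cdot>\<^sub>m 1\<^sub>m n) * poly_mat A q + A * poly_mat A p * poly_mat A q
      = poly_mat A (pCons a p) * poly_mat A q"
    unfolding poly_mat_pCons by (rule add_mult_distrib_mat[symmetric, of _ n n _ _ n]) auto
  finally show ?case .
qed

lemma poly_mat_dvd_eq_0:
  assumes "p dvd q" and "poly_mat A p = 0\<^sub>m n n"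
  shows "poly_mat A q = 0\<^sub>m n n"
  using assms by (auto elim!: dvdE simp: poly_mat_mult left_mult_zero_mat[of _ n n])

lemma poly_mat_sum_index:
  assumes "finite I" and "i < n" and "j < n"
  shows "poly_mat A (\<Sum>x\<in>I. f x) $$ (i, j) = (\<Sum>x\<in>I. poly_mat A (f x) $$ (i, j))"
  using assms(1) by induction (use assms(2,3) in \<open>auto simp: poly_mat_0 poly_mat_add\<close>)

end

text \<open>
  If the columns of \<open>P\<close> span an \<open>A\<close>-stable submodule on which \<open>A\<close> acts by \<open>B\<close>, then \<open>p(A)\<close> acts
  on it by \<open>p(B)\<close>.
\<close>

lemma poly_mat_intertwine:
  assumes A [simp]: "A \<in> carrier_mat n n" and B [simp]: "B \<in> carrier_mat m m"
    and P [simp]: "P \<in> carrier_mat n m" and AP: "A * P = P * B"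
  shows "poly_mat A p * P = P * poly_mat B p"
proof (induction p)
  case 0
  show ?case by (simp add: poly_mat_0[OF A] poly_mat_0[OF B] left_mult_zero_mat[of _ n m] right_mult_zero_mat[of _ n m])
next
  case (pCons a p)
  note pm [simp] = poly_mat_carrier[OF A] poly_mat_carrier[OF B]
  have "poly_mat A (pCons a p) * P = a \<cdot>\<^sub>m P + A * (poly_mat A p * P)"
    unfolding poly_mat_pCons[OF A]
    by (subst add_mult_distrib_mat[of _ n n _ _ m])
      (simp_all add: mult_carrier_mat[of _ n n] left_mult_one_mat[of _ n m] mult_smult_assoc_mat[of _ n n _ m] assoc_mult_mat[of _ n n _ n _ m])
  also have "\<dots> = a \<cdot>\<^sub>m P + P * (B * poly_mat B p)"
    by (simp add: pCons.IH assoc_mult_mat[symmetric, of _ n n _ m _ m]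
        assoc_mult_mat[symmetric, of _ n m _ m _ m] AP del: assoc_mult_mat)
  also have "\<dots> = P * poly_mat B (pCons a p)"
    unfolding poly_mat_pCons[OF B]
    by (subst mult_add_distrib_mat[of _ n m _ m])
      (simp_all add: mult_carrier_mat[of _ m m] right_mult_one_mat[of _ n m] mult_smult_distrib[of _ n m _ m])
  finally show ?case .
qed

text \<open>
  For a matrix \<open>M\<close> over \<open>R[t]\<close>, let \<open>ev(M)\<close> be the matrix whose column \<open>j\<close> is
  \<open>\<Sum>k. M\<^sub>k\<^sub>j(A) e\<^sub>k\<close>, that is, the image of column \<open>j\<close> of \<open>M\<close> under the \<open>R[t]\<close>-linear map
  from \<open>R[t]\<^sup>n\<close> to \<open>R\<^sup>n\<close> that fixes the standard basis, \<open>t\<close> acting on \<open>R\<^sup>n\<close> as \<open>A\<close>. Linearity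
  shows that \<open>ev(M) = 0\<close> implies \<open>ev(M N) = 0\<close> for every \<open>N\<close>. Now \<open>ev(t I - A) = 0\<close>, and taking
  the adjugate for \<open>N\<close> gives \<open>0 = ev(\<chi>(A) I) = \<chi>(A)\<close>.
\<close>

theorem cayley_hamilton:
  fixes A :: "'a :: comm_ring_1 mat"
  assumes A [simp]: "A \<in> carrier_mat n n"
  shows "poly_mat A (char_poly A) = 0\<^sub>m n n"
proof (rule eq_matI)
  fix i j assume "i < dim_row (0\<^sub>m n n :: 'a mat)" and "j < dim_col (0\<^sub>m n n :: 'a mat)"
  then have i: "i < n" and j: "j < n" by simp_all
  let ?ev = "poly_mat A"
  define M where "M = char_poly_matrix A"
  define N where "N = adj_mat M"
  note [simp] = carrier_matD[OF A] carrier_matD[OF poly_mat_carrier[OF A]] poly_mat_carrier[OF A]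
  have M [simp]: "M \<in> carrier_mat n n" by (simp add: M_def)
  have N [simp]: "N \<in> carrier_mat n n" and MN: "M * N = char_poly A \<cdot>\<^sub>m 1\<^sub>m n"
    using adj_mat[OF M] by (simp_all add: N_def M_def char_poly_def)
  note [simp] = carrier_matD[OF M] carrier_matD[OF N]
  have M_index: "M $$ (k, l) = (if k = l then [:0, 1:] else 0) + [:- A $$ (k, l):]"
    if "k < n" "l < n" for k l
    using that by (simp add: M_def char_poly_matrix_def)
  have col_sum: "(\<Sum>k<n. ?ev (M $$ (k, l)) $$ (m, k)) = 0" if m: "m < n" and l: "l < n" for m l
  proof -
    have "(\<Sum>k<n. ?ev (M $$ (k, l)) $$ (m, k))
        = (\<Sum>k<n. (if k = l then A $$ (m, k) else 0) + (if k = m then - A $$ (k, l) else 0))"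
      by (rule sum.cong[OF refl])
        (use m l in \<open>auto simp: M_index poly_mat_add[OF A] poly_mat_X[OF A] poly_mat_0[OF A]
            poly_mat_const[OF A] simp del: add_pCons\<close>)
    also have "\<dots> = 0" using m l by (simp add: sum.distrib)
    finally show ?thesis .
  qed
  have "?ev (char_poly A) $$ (i, j) = (\<Sum>k<n. if k = j then ?ev (char_poly A) $$ (i, k) else 0)"
    using j by simp
  also have "\<dots> = (\<Sum>k<n. ?ev ((M * N) $$ (k, j)) $$ (i, k))"
    by (rule sum.cong[OF refl]) (use i j in \<open>auto simp: MN poly_mat_0[OF A]\<close>)
  also have "\<dots> = (\<Sum>k<n. \<Sum>l<n. ?ev (N $$ (l, j) * M $$ (k, l)) $$ (i, k))"
    by (rule sum.cong[OF refl])
      (use i j in \<open>auto simp: scalar_prod_def poly_mat_sum_index[OF A] atLeast0LessThan mult.commute\<close>)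
  also have "\<dots> = (\<Sum>k<n. \<Sum>l<n. \<Sum>m<n. ?ev (N $$ (l, j)) $$ (i, m) * ?ev (M $$ (k, l)) $$ (m, k))"
    by (intro sum.cong refl)
      (use i j in \<open>auto simp: poly_mat_mult[OF A] scalar_prod_def atLeast0LessThan\<close>)
  also have "\<dots> = (\<Sum>l<n. \<Sum>m<n. \<Sum>k<n. ?ev (N $$ (l, j)) $$ (i, m) * ?ev (M $$ (k, l)) $$ (m, k))"
    by (subst sum.swap, rule sum.cong[OF refl], rule sum.swap)
  also have "\<dots> = (\<Sum>l<n. \<Sum>m<n. ?ev (N $$ (l, j)) $$ (i, m) * (\<Sum>k<n. ?ev (M $$ (k, l)) $$ (m, k)))"
    by (simp add: sum_distrib_left)
  also have "\<dots> = 0" by (simp add: col_sum)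
  finally show "?ev (char_poly A) $$ (i, j) = 0\<^sub>m n n $$ (i, j)" using i j by simp
qed (simp_all add: carrier_matD[OF poly_mat_carrier[OF A]])

section \<open>The companion matrix\<close>

lemma mat_eq_by_unit_vecs:
  fixes M N :: "'a :: semiring_1 mat"
  assumes "M \<in> carrier_mat m n" and "N \<in> carrier_mat m n"
    and "\<And>j. j < n \<Longrightarrow> M *\<^sub>v unit_vec n j = N *\<^sub>v unit_vec n j"
  shows "M = N"
proof (rule eq_matI)
  fix i j assume ij: "i < dim_row N" "j < dim_col N"
  then have "(M *\<^sub>v unit_vec n j) $ i = (N *\<^sub>v unit_vec n j) $ i"
    using assms by simp
  then show "M $$ (i, j) = N $$ (i, j)"
    using ij assms(1,2) by simp
qed (use assms in auto)

context
  fixes h :: "'a :: comm_ring_1 poly" and n :: nat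
  assumes monic_h: "monic h" and deg_h: "degree h = n" and n_pos: "n \<ge> 1"
begin

private abbreviation (input) C where "C \<equiv> companion_matrix h"

lemma companion_carrier [simp]: "C \<in> carrier_mat n n"
  by (simp add: companion_matrix_def deg_h)

lemma companion_mult_vec:
  assumes v: "v \<in> carrier_vec n"
  shows "C *\<^sub>v v = vec n (\<lambda>i. (if i = 0 then 0 else v $ (i - 1)) - coeff h i * v $ (n - 1))"
proof (rule eq_vecI)
  fix i assume "i < dim_vec (vec n (\<lambda>i. (if i = 0 then 0 else v $ (i - 1)) - coeff h i * v $ (n - 1)))"
  then have i: "i < n" by simp
  have "(C *\<^sub>v v) $ i = (\<Sum>j<n. C $$ (i, j) * v $ j)"
    using i v by (simp add: scalar_prod_def atLeast0LessThan carrier_matD[OF companion_carrier])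
  also have "\<dots> = (\<Sum>j<n. (if j = n - 1 then - coeff h i * v $ (n - 1) else 0)
      + (if j = i - 1 then (if i = 0 then 0 else v $ (i - 1)) else 0))"
    by (rule sum.cong[OF refl]) (use i n_pos in \<open>auto simp: companion_matrix_def deg_h\<close>)
  also have "\<dots> = (if i = 0 then 0 else v $ (i - 1)) - coeff h i * v $ (n - 1)"
    using i n_pos by (simp add: sum.distrib)
  finally show "(C *\<^sub>v v) $ i = vec n (\<lambda>i. (if i = 0 then 0 else v $ (i - 1)) - coeff h i * v $ (n - 1)) $ i"
    using i by simp
qed (simp add: carrier_matD[OF companion_carrier])

lemmas poly_mat_C [simp] = poly_mat_carrier[OF companion_carrier]
lemmas [simp] = carrier_matD[OF companion_carrier] carrier_matD[OF poly_mat_C]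

lemma poly_mat_companion_pCons_vec:
  assumes v: "v \<in> carrier_vec n"
  shows "poly_mat C (pCons a p) *\<^sub>v v = a \<cdot>\<^sub>v v + C *\<^sub>v (poly_mat C p *\<^sub>v v)"
proof -
  have "poly_mat C (pCons a p) *\<^sub>v v = (a \<cdot>\<^sub>m 1\<^sub>m n) *\<^sub>v v + (C * poly_mat C p) *\<^sub>v v"
    unfolding poly_mat_pCons[OF companion_carrier]
    by (rule add_mult_distrib_mat_vec[of _ n n]) (use v in \<open>auto intro!: mult_carrier_mat[of _ n n]\<close>)
  also have "(a \<cdot>\<^sub>m 1\<^sub>m n) *\<^sub>v v = a \<cdot>\<^sub>v v"
    using v by (auto intro!: eq_vecI simp: row_smult)
  also have "(C * poly_mat C p) *\<^sub>v v = C *\<^sub>v (poly_mat C p *\<^sub>v v)"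
    by (rule assoc_mult_mat_vec[of _ n n _ n]) (use v in auto)
  finally show ?thesis .
qed

text \<open>
  The first basis vector is cyclic: \<open>C\<^sup>i e\<^sub>0 = e\<^sub>i\<close> for \<open>i < n\<close>. So the map \<open>p \<mapsto> p(C) e\<^sub>0\<close> reads
  off the coefficients of a polynomial of degree less than \<open>n\<close>.
\<close>

lemma poly_mat_companion_e0:
  "degree p < n \<Longrightarrow> poly_mat C p *\<^sub>v unit_vec n 0 = vec n (coeff p)"
proof (induction p)
  case 0
  then show ?case by (auto simp: poly_mat_0[OF companion_carrier] intro!: eq_vecI)
next
  case (pCons a p)
  then have p: "coeff p (n - 1) = 0" and deg: "degree p < n"
    by (auto simp: coeff_eq_0 split: if_splits)
  show ?case
    unfolding poly_mat_companion_pCons_vec[OF unit_vec_carrier] pCons.IH[OF deg]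
      companion_mult_vec[OF vec_carrier]
    using n_pos p by (auto intro!: eq_vecI simp: coeff_pCons split: nat.split)
qed

lemma poly_mat_companion_monom:
  assumes "j < n"
  shows "poly_mat C (monom 1 j) *\<^sub>v unit_vec n 0 = unit_vec n j"
  using assms degree_monom_le[of "1::'a" j]
  by (subst poly_mat_companion_e0) (auto intro!: eq_vecI)

lemma commute_companion_imp_commute_poly_mat:
  assumes "e \<in> carrier_mat n n" and "C * e = e * C"
  shows "poly_mat C p * e = e * poly_mat C p"
  by (rule poly_mat_intertwine) (use assms in auto)

lemma eq_if_commute_companion:
  assumes e: "e \<in> carrier_mat n n" "C * e = e * C"
    and f: "f \<in> carrier_mat n n" "C * f = f * C"
    and eq: "e *\<^sub>v unit_vec n 0 = f *\<^sub>v unit_vec n 0"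
  shows "e = f"
proof (rule mat_eq_by_unit_vecs[OF e(1) f(1)])
  fix j assume j: "j < n"
  have "g *\<^sub>v unit_vec n j = poly_mat C (monom 1 j) *\<^sub>v (g *\<^sub>v unit_vec n 0)"
    if g: "g \<in> carrier_mat n n" "C * g = g * C" for g
  proof -
    have "g *\<^sub>v unit_vec n j = g *\<^sub>v (poly_mat C (monom 1 j) *\<^sub>v unit_vec n 0)"
      using j by (simp add: poly_mat_companion_monom)
    also have "\<dots> = (poly_mat C (monom 1 j) * g) *\<^sub>v unit_vec n 0"
      unfolding commute_companion_imp_commute_poly_mat[OF g]
      by (rule assoc_mult_mat_vec[symmetric, of _ n n _ n]) (use g in auto)
    also have "\<dots> = poly_mat C (monom 1 j) *\<^sub>v (g *\<^sub>v unit_vec n 0)"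
      by (rule assoc_mult_mat_vec[of _ n n _ n]) (use g in auto)
    finally show ?thesis .
  qed
  from this[OF e] this[OF f] eq show "e *\<^sub>v unit_vec n j = f *\<^sub>v unit_vec n j" by simp
qed

lemma companion_commute_poly_mat: "C * poly_mat C p = poly_mat C p * C"
  using commute_companion_imp_commute_poly_mat[of C p] by simp

lemma commute_companion_obtains_poly:
  assumes e: "e \<in> carrier_mat n n" "C * e = e * C"
  obtains p where "e = poly_mat C p"
proof
  define p where "p = (\<Sum>i<n. monom ((e *\<^sub>v unit_vec n 0) $ i) i)"
  have p: "coeff p k = (if k < n then (e *\<^sub>v unit_vec n 0) $ k else 0)" for k
    by (auto simp: p_def coeff_sum)
  have "degree p \<le> n - 1" by (rule degree_le) (use p n_pos in auto)
  then have deg: "degree p < n" using n_pos by simp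
  show "e = poly_mat C p"
    by (rule eq_if_commute_companion[OF e poly_mat_C companion_commute_poly_mat])
      (use e in \<open>auto simp: poly_mat_companion_e0[OF deg] p intro!: eq_vecI\<close>)
qed

text \<open>
  In degree \<open>n\<close> the coefficients of \<open>h\<close> in the last column of \<open>C\<close> cancel those that \<open>h(C)\<close> would
  otherwise produce in \<open>h(C) e\<^sub>0\<close>.
\<close>

lemma poly_mat_companion_self: "poly_mat C h = 0\<^sub>m n n"
proof (rule eq_if_commute_companion[OF poly_mat_C companion_commute_poly_mat])
  \<comment> \<open>Splitting off one power of \<open>t\<close> leaves \<open>g\<close> of degree \<open>n - 1\<close>, within reach of the coefficient formula.\<close>
  obtain a g where h: "h = pCons a g" by (cases h)
  have g: "coeff g (n - 1) = 1"
    using monic_h deg_h n_pos by (cases n) (auto simp: h)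
  have deg: "degree g < n"
    using deg_h n_pos by (auto simp: h split: if_splits)
  have hc: "coeff h i = (case i of 0 \<Rightarrow> a | Suc k \<Rightarrow> coeff g k)" for i
    by (simp add: h coeff_pCons)
  have "poly_mat C h *\<^sub>v unit_vec n 0 = a \<cdot>\<^sub>v unit_vec n 0 + C *\<^sub>v vec n (coeff g)"
    by (simp add: poly_mat_companion_pCons_vec[OF unit_vec_carrier, of a g, folded h]
        poly_mat_companion_e0[OF deg])
  also have "\<dots> = 0\<^sub>v n"
    using g n_pos by (auto simp: companion_mult_vec hc split: nat.split intro!: eq_vecI)
  finally have "poly_mat C h *\<^sub>v unit_vec n 0 = 0\<^sub>v n" .
  then show "poly_mat C h *\<^sub>v unit_vec n 0 = 0\<^sub>m n n *\<^sub>v unit_vec n 0"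
    by (auto intro!: eq_vecI)
qed (auto simp: left_mult_zero_mat[of _ n n] right_mult_zero_mat[of _ n n])

lemma poly_mat_companion_eq_0_iff: "poly_mat C q = 0\<^sub>m n n \<longleftrightarrow> h dvd q"
proof
  assume "h dvd q"
  then show "poly_mat C q = 0\<^sub>m n n"
    by (rule poly_mat_dvd_eq_0[OF companion_carrier _ poly_mat_companion_self])
next
  assume q: "poly_mat C q = 0\<^sub>m n n"
  obtain s r where sr: "q = h * s + r" "r = 0 \<or> degree r < degree h"
    using monic_division[OF monic_h] .
  then have deg: "degree r < n" using n_pos deg_h by auto
  have "poly_mat C r = 0\<^sub>m n n"
    using q unfolding sr(1) poly_mat_add[OF companion_carrier] poly_mat_mult[OF companion_carrier]
      poly_mat_companion_self
    by (simp add: left_mult_zero_mat[of _ n n] left_add_zero_mat[of _ n n] del: index_mult_mat)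
  then have "vec n (coeff r) = 0\<^sub>m n n *\<^sub>v unit_vec n 0"
    using poly_mat_companion_e0[OF deg] by simp
  also have "\<dots> = 0\<^sub>v n" by (auto intro!: eq_vecI)
  finally have "vec n (coeff r) = 0\<^sub>v n" .
  then have "coeff r i = 0" if "i < n" for i
    using that by (metis index_vec index_zero_vec(1))
  then have "r = 0" using deg by (metis leading_coeff_0_iff)
  then show "h dvd q" by (simp add: sr(1))
qed

text \<open>
  No determinant is expanded: by Cayley--Hamilton \<open>h\<close> divides the characteristic polynomial, and both
  are monic of degree \<open>n\<close>.
\<close>

lemma char_poly_companion: "char_poly C = h"
proof (rule monic_dvd_imp_eq[OF monic_h])
  from degree_monic_char_poly[OF companion_carrier]
  show "monic (char_poly C)" "degree (char_poly C) \<le> degree h" by (simp_all add: deg_h)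
  show "h dvd char_poly C"
    using cayley_hamilton[OF companion_carrier] by (simp add: poly_mat_companion_eq_0_iff)
qed

end

section \<open>The characteristic polynomial on a free direct summand\<close>

lemma poly_char_poly_eq_det:
  fixes A :: "'a :: comm_ring_1 mat"
  assumes A: "A \<in> carrier_mat n n"
  shows "poly (char_poly A) r = det (r \<cdot>\<^sub>m 1\<^sub>m n - A)"
  unfolding char_poly_def
  by (rule poly_det_cong[of _ n]) (use A in \<open>auto simp: char_poly_matrix_def\<close>)

lemma det_dvd_one_if_left_inverse:
  fixes A :: "'a :: comm_ring_1 mat"
  assumes "A \<in> carrier_mat n n" and "B \<in> carrier_mat n n" and "B * A = 1\<^sub>m n"
  shows "det A dvd 1"
  using det_mult[OF assms(2,1)] assms(3) by (metis det_one dvd_triv_right)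

text \<open>
  Two free summands of ranks \<open>k\<close> and \<open>l\<close> that are independent in \<open>R\<^sup>n\<close> satisfy \<open>k + l \<le> n\<close>, as
  \<open>R\<close> is commutative with \<open>1 \<noteq> 0\<close>: otherwise, padding the injection \<open>[P P']\<close> with zero rows gives a
  square matrix that has a left inverse and determinant \<open>0\<close>.
\<close>

lemma rank_sum_le_if_block_left_inverse:
  fixes P :: "'a :: comm_ring_1 mat"
  assumes P: "P \<in> carrier_mat n k" and P': "P' \<in> carrier_mat n l"
    and Q: "Q \<in> carrier_mat k n" and Q': "Q' \<in> carrier_mat l n"
    and 1: "Q * P = 1\<^sub>m k" "Q * P' = 0\<^sub>m k l" "Q' * P = 0\<^sub>m l k" "Q' * P' = 1\<^sub>m l"
  shows "k + l \<le> n"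
proof (rule ccontr)
  assume "\<not> k + l \<le> n"
  then obtain d where d: "k + l = n + d" and d0: "d > 0" by (metis add_diff_inverse_nat not_le zero_less_diff less_imp_le)
  define X where "X = four_block_mat P P' (0\<^sub>m d k) (0\<^sub>m d l)"
  define Y where "Y = four_block_mat Q (0\<^sub>m k d) Q' (0\<^sub>m l d)"
  have X: "X \<in> carrier_mat (k + l) (k + l)"
    using four_block_carrier_mat[OF P zero_carrier_mat[of d l]] d by (simp add: X_def)
  have Y: "Y \<in> carrier_mat (k + l) (k + l)"
    using four_block_carrier_mat[OF Q zero_carrier_mat[of l d]] d by (simp add: Y_def)
  have "Y * X = 1\<^sub>m (k + l)"
    unfolding X_def Y_def
    by (subst mult_four_block_mat[OF Q _ Q' _ P P']) (use 1 in auto)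
  then have "det X dvd 1" by (rule det_dvd_one_if_left_inverse[OF X Y])
  moreover have "det X = 0"
  proof -
    have "X = mat\<^sub>r (k + l) (k + l) (\<lambda>i. if i = n then 0\<^sub>v (k + l) else row X i)"
      by (rule eq_rowI) (use X P P' d d0 in \<open>auto simp: X_def intro!: eq_vecI\<close>)
    also have "det \<dots> = 0"
      by (rule det_row_0) (use X d d0 in auto)
    finally show ?thesis .
  qed
  ultimately show False by simp
qed

text \<open>
  Here \<open>e = P Q\<close> is an idempotent that commutes with \<open>A\<close>, the columns of \<open>P\<close> are a basis of its
  image, and \<open>W\<close> inverts \<open>r I - A\<close> on the image. The polynomial \<open>g\<close> is the characteristic polynomial
  of the matrix \<open>Q A P\<close> of the restriction of \<open>A\<close> to the image.
\<close>

lemma char_poly_of_free_summand: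
  fixes A :: "'a :: comm_ring_1 mat"
  assumes A: "A \<in> carrier_mat n n" and P: "P \<in> carrier_mat n k" and Q: "Q \<in> carrier_mat k n"
    and W: "W \<in> carrier_mat n n"
    and QP: "Q * P = 1\<^sub>m k" and comm: "A * (P * Q) = (P * Q) * A"
    and inv: "W * ((r \<cdot>\<^sub>m 1\<^sub>m n - A) * (P * Q)) = P * Q"
  obtains g where "monic g" and "degree g = k" and "poly g r dvd 1"
    and "poly_mat A g * (P * Q) = 0\<^sub>m n n"
proof
  define B where "B = Q * A * P"
  note cs = A P Q W
  have B: "B \<in> carrier_mat k k" using cs by (simp add: B_def)
  show "monic (char_poly B)" "degree (char_poly B) = k"
    using degree_monic_char_poly[OF B] by auto
  have PQP: "(P * Q) * P = P"
    using cs QP by (simp add: assoc_mult_mat[of _ n k _ n _ k])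
  have AP: "A * P = P * B"
  proof -
    have "A * P = A * ((P * Q) * P)" by (simp add: PQP)
    also have "\<dots> = (A * (P * Q)) * P"
      by (rule assoc_mult_mat[symmetric, of _ n n _ n _ k]) (use cs in auto)
    also have "\<dots> = P * B"
      unfolding comm B_def using cs by (simp add: assoc_mult_mat[of _ n k _ n] assoc_mult_mat[of _ k n _ n] assoc_mult_mat[of _ n n _ n])
    finally show ?thesis .
  qed
  have "poly_mat A (char_poly B) * (P * Q) = (poly_mat A (char_poly B) * P) * Q"
    by (rule assoc_mult_mat[symmetric, of _ n n _ k _ n]) (use cs poly_mat_carrier[OF A] in auto)
  also have "\<dots> = 0\<^sub>m n n"
    unfolding poly_mat_intertwine[OF A B P AP] cayley_hamilton[OF B]
    using cs by (simp add: right_mult_zero_mat[of _ n k] left_mult_zero_mat[of _ k n])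
  finally show "poly_mat A (char_poly B) * (P * Q) = 0\<^sub>m n n" .
  have RA: "r \<cdot>\<^sub>m 1\<^sub>m n - A \<in> carrier_mat n n" using A by auto
  have RB: "r \<cdot>\<^sub>m 1\<^sub>m k - B \<in> carrier_mat k k" using B by auto
  have rAP: "(r \<cdot>\<^sub>m 1\<^sub>m n - A) * P = P * (r \<cdot>\<^sub>m 1\<^sub>m k - B)"
    using cs B AP by (simp add: minus_mult_distrib_mat[of _ n n _ _ k] mult_minus_distrib_mat[of _ n k _ k]
        mult_smult_assoc_mat[of _ n n _ k] mult_smult_distrib[of _ n k _ k])
  have "(Q * W * P) * (r \<cdot>\<^sub>m 1\<^sub>m k - B) = Q * (W * (P * (r \<cdot>\<^sub>m 1\<^sub>m k - B)))"
    using cs RB by (simp add: assoc_mult_mat[of _ k n _ k _ k] assoc_mult_mat[of _ k n _ n _ k] assoc_mult_mat[of _ n n _ k _ k])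
  also have "P * (r \<cdot>\<^sub>m 1\<^sub>m k - B) = (r \<cdot>\<^sub>m 1\<^sub>m n - A) * ((P * Q) * P)"
    unfolding PQP by (rule rAP[symmetric])
  also have "\<dots> = ((r \<cdot>\<^sub>m 1\<^sub>m n - A) * (P * Q)) * P"
    by (rule assoc_mult_mat[symmetric, of _ n n _ n _ k]) (use cs RA in auto)
  also have "W * \<dots> = (W * ((r \<cdot>\<^sub>m 1\<^sub>m n - A) * (P * Q))) * P"
    by (rule assoc_mult_mat[symmetric, of _ n n _ n _ k]) (use cs RA in auto)
  also have "Q * \<dots> = 1\<^sub>m k" unfolding inv PQP by (rule QP)
  finally have "det (r \<cdot>\<^sub>m 1\<^sub>m k - B) dvd 1"
    by (rule det_dvd_one_if_left_inverse[OF RB, rotated]) (use cs in auto)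
  then show "poly (char_poly B) r dvd 1" by (simp add: poly_char_poly_eq_det[OF B])
qed

section \<open>The image of an idempotent matrix over a projective-free ring\<close>

text \<open>
  Linear combinations, spans and linear dependence in the module \<open>R\<^sup>n\<close> of vectors over the whole
  type, regarded as a ring record.
\<close>

abbreviation vec_lincomb :: "nat \<Rightarrow> ('a :: comm_ring_1 vec \<Rightarrow> 'a) \<Rightarrow> 'a vec set \<Rightarrow> 'a vec" where
  "vec_lincomb n \<equiv> LinearCombinations.module.lincomb (module_vec TYPE('a) n)"

abbreviation vec_span :: "nat \<Rightarrow> 'a :: comm_ring_1 vec set \<Rightarrow> 'a vec set" where
  "vec_span n \<equiv> LinearCombinations.module.span class_ring (module_vec TYPE('a) n)"

abbreviation vec_lin_dep :: "nat \<Rightarrow> 'a :: comm_ring_1 vec set \<Rightarrow> bool" where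
  "vec_lin_dep n \<equiv> LinearCombinations.module.lin_dep class_ring (module_vec TYPE('a) n)"

lemma module_class_ring: "module (class_ring :: 'a :: comm_ring_1 ring) (module_vec TYPE('a) n)"
  by unfold_locales
    (auto simp: module_vec_simps class_ring_simps Units_def add_smult_distrib_vec
      smult_add_distrib_vec intro!: bexI[of _ "- _"])

lemma vec_span_iff:
  "v \<in> vec_span n S \<longleftrightarrow> (\<exists>a A. finite A \<and> A \<subseteq> S \<and> v = vec_lincomb n a A)"
  unfolding module.span_def[OF module_class_ring] by auto

lemma vec_lin_dep_iff:
  "vec_lin_dep n S \<longleftrightarrow>
    (\<exists>A a v. finite A \<and> A \<subseteq> S \<and> vec_lincomb n a A = 0\<^sub>v n \<and> v \<in> A \<and> a v \<noteq> 0)"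
  unfolding module.lin_dep_def[OF module_class_ring] by (simp add: module_vec_simps)

lemma abelian_monoid_if_module: "module R M \<Longrightarrow> abelian_monoid M"
  by (intro abelian_group.axioms(1) module.axioms(2))

lemma module_hom_finsum:
  assumes A: "module R A" and B: "module R B" and g: "g \<in> module_hom R A B"
    and "finite I" and "\<And>i. i \<in> I \<Longrightarrow> h i \<in> carrier A"
  shows "g (finsum A h I) = finsum B (\<lambda>i. g (h i)) I"
proof -
  have zero: "g \<zero>\<^bsub>A\<^esub> = \<zero>\<^bsub>B\<^esub>"
    by (intro mod_hom.f0_is_0[of R A B g] mod_hom.intro mod_hom_axioms.intro A B g)
  note monoids = abelian_monoid_if_module[OF A] abelian_monoid_if_module[OF B]
  show ?thesis
    using assms(4,5)
  proof (induction I)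
    case empty
    show ?case using monoids zero by (simp add: abelian_monoid.finsum_empty)
  next
    case (insert i I)
    have hA: "h \<in> I \<rightarrow> carrier A" "h i \<in> carrier A" using insert.prems by auto
    then have gB: "(\<lambda>i. g (h i)) \<in> I \<rightarrow> carrier B" "g (h i) \<in> carrier B"
      using module_hom_closed[OF g] by auto
    have "g (finsum A h (insert i I)) = g (h i \<oplus>\<^bsub>A\<^esub> finsum A h I)"
      using abelian_monoid.finsum_insert[OF monoids(1) insert.hyps hA] by simp
    also have "\<dots> = g (h i) \<oplus>\<^bsub>B\<^esub> g (finsum A h I)"
      by (rule module_hom_add[OF g hA(2) abelian_monoid.finsum_closed[OF monoids(1) hA(1)]])
    also have "g (finsum A h I) = finsum B (\<lambda>i. g (h i)) I"
      using insert.IH insert.prems by simp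
    also have "g (h i) \<oplus>\<^bsub>B\<^esub> finsum B (\<lambda>i. g (h i)) I = finsum B (\<lambda>i. g (h i)) (insert i I)"
      using abelian_monoid.finsum_insert[OF monoids(2) insert.hyps gB] by simp
    finally show ?case .
  qed
qed

text \<open>
  The image of an idempotent \<open>n \<times> n\<close> matrix \<open>e\<close>, as a submodule of \<open>R\<^sup>n\<close>. It is described as the
  set of fixed vectors of \<open>e\<close>, which is the image exactly because \<open>e\<close> is idempotent.
\<close>

definition image_module :: "nat \<Rightarrow> 'a :: comm_ring_1 mat \<Rightarrow> ('a, 'a vec) module" where
  "image_module n e = (module_vec TYPE('a) n) \<lparr>carrier := {v \<in> carrier_vec n. e *\<^sub>v v = v}\<rparr>"

context
  fixes e :: "'a :: comm_ring_1 mat" and n :: nat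
  assumes e [simp]: "e \<in> carrier_mat n n" and idem: "e * e = e"
begin

lemmas [simp] = carrier_matD[OF e]

lemma mult_mat_smult_vec: "v \<in> carrier_vec n \<Longrightarrow> e *\<^sub>v (c \<cdot>\<^sub>v v) = c \<cdot>\<^sub>v (e *\<^sub>v v)"
  by (auto intro!: eq_vecI)

lemma mult_mat_zero_vec: "e *\<^sub>v 0\<^sub>v n = 0\<^sub>v n"
  by (auto intro!: eq_vecI)

private abbreviation (input) M where "M \<equiv> image_module n e"
private abbreviation (input) N where "N \<equiv> {v \<in> carrier_vec n. e *\<^sub>v v = v}"

lemma image_simps:
  "carrier M = N" "add M = (+)" "zero M = 0\<^sub>v n" "module.smult M = (\<cdot>\<^sub>v)"
  by (simp_all add: image_module_def module_vec_simps)

lemma submodule_image: "submodule (class_ring :: 'a ring) N (module_vec TYPE('a) n)"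
  unfolding submodule_def
  using module_class_ring[of n, where 'a='a]
  by (auto simp: module_vec_simps mult_add_distrib_mat_vec[OF e] mult_mat_smult_vec mult_mat_zero_vec)

lemma module_image: "module class_ring M"
  unfolding image_module_def
  by (rule module.submodule_is_module[OF module_class_ring submodule_image])

lemma mult_idem_mem_image: "v \<in> carrier_vec n \<Longrightarrow> e *\<^sub>v v \<in> N"
  using assoc_mult_mat_vec[OF e e, of v] mult_mat_vec_carrier[OF e, of v] idem by auto

lemma mult_unit_vec: "j < n \<Longrightarrow> e *\<^sub>v unit_vec n j = col e j"
  by (auto intro!: eq_vecI)

lemma col_mem_image: "j < n \<Longrightarrow> col e j \<in> N"
  using mult_idem_mem_image[of "unit_vec n j"] by (simp only: mult_unit_vec unit_vec_carrier)

lemma set_cols_subset: "set (cols e) \<subseteq> N"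
proof
  fix v assume "v \<in> set (cols e)"
  then obtain j where "j < n" "v = col e j" by (auto simp: cols_def)
  then show "v \<in> N" using col_mem_image by blast
qed

text \<open>
  Spans and linear dependence may be computed in \<open>R\<^sup>n\<close> instead of in the image.
\<close>

lemma span_image:
  assumes "S \<subseteq> N"
  shows "LinearCombinations.module.span class_ring M S = vec_span n S"
    and "LinearCombinations.module.lin_dep class_ring M S = vec_lin_dep n S"
  using module.span_li_not_depend[OF module_class_ring assms submodule_image]
  by (simp_all add: image_module_def)

lemma span_cols: "vec_span n (set (cols e)) = N"
proof
  show "vec_span n (set (cols e)) \<subseteq> N"
    using module.span_is_subset[OF module_class_ring set_cols_subset submodule_image] .
  show "N \<subseteq> vec_span n (set (cols e))"
  proof
    fix v assume v: "v \<in> N"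
    have "v = mat_of_cols n (cols e) *\<^sub>v v"
      using v mat_of_cols_cols[of e] by auto
    also have "\<dots> = vec_lincomb n (\<lambda>l. \<Sum>i = 0..<length (cols e). if l = cols e ! i then v $ i else 0) (set (cols e))"
      by (rule vec_module.mat_of_cols_mult_as_finsum) (use v in auto)
    finally show "v \<in> vec_span n (set (cols e))"
      unfolding vec_span_iff by blast
  qed
qed

lemma finitely_generated_image: "finitely_generated_module class_ring M"
  unfolding finitely_generated_module_def
  using module_image set_cols_subset span_cols
  by (auto simp: image_simps span_image intro!: exI[of _ "set (cols e)"])


lemma finsum_cols:
  assumes v: "v \<in> carrier_vec n"
  shows "finsum M (\<lambda>j. v $ j \<cdot>\<^sub>v col e j) {..<n} = e *\<^sub>v v"
proof -
  have monoid: "abelian_monoid M" by (rule abelian_monoid_if_module[OF module_image])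
  have mem: "c \<cdot>\<^sub>v col e j \<in> carrier M" if "j < n" for c j
    using module.smult_closed[OF module_image, of c "col e j"] col_mem_image[OF that]
    by (simp add: image_simps)
  have "finsum M (\<lambda>j. v $ j \<cdot>\<^sub>v col e j) {..<m} = e *\<^sub>v vec n (\<lambda>j. if j < m then v $ j else 0)"
    if "m \<le> n" for m
    using that
  proof (induction m)
    case 0
    show ?case
      using mult_mat_zero_vec abelian_monoid.finsum_empty[OF monoid]
      by (simp add: image_simps zero_vec_def)
  next
    case (Suc m)
    have "finsum M (\<lambda>j. v $ j \<cdot>\<^sub>v col e j) {..<Suc m}
        = v $ m \<cdot>\<^sub>v col e m + e *\<^sub>v vec n (\<lambda>j. if j < m then v $ j else 0)"
      using Suc abelian_monoid.finsum_insert[OF monoid, of "{..<m}" m "\<lambda>j. v $ j \<cdot>\<^sub>v col e j"] mem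
      by (simp add: lessThan_Suc image_simps(2))
    also have "v $ m \<cdot>\<^sub>v col e m = e *\<^sub>v (v $ m \<cdot>\<^sub>v unit_vec n m)"
      using Suc.prems by (simp add: mult_mat_smult_vec mult_unit_vec)
    also have "e *\<^sub>v (v $ m \<cdot>\<^sub>v unit_vec n m) + e *\<^sub>v vec n (\<lambda>j. if j < m then v $ j else 0)
        = e *\<^sub>v (v $ m \<cdot>\<^sub>v unit_vec n m + vec n (\<lambda>j. if j < m then v $ j else 0))"
      by (rule mult_add_distrib_mat_vec[OF e, symmetric]) auto
    also have "v $ m \<cdot>\<^sub>v unit_vec n m + vec n (\<lambda>j. if j < m then v $ j else 0)
        = vec n (\<lambda>j. if j < Suc m then v $ j else 0)"
      using Suc.prems by (auto intro!: eq_vecI simp: less_Suc_eq)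
    finally show ?case .
  qed
  from this[of n] have "finsum M (\<lambda>j. v $ j \<cdot>\<^sub>v col e j) {..<n}
      = e *\<^sub>v vec n (\<lambda>j. if j < n then v $ j else 0)" by simp
  also have "vec n (\<lambda>j. if j < n then v $ j else 0) = v"
    using v by (auto intro!: eq_vecI)
  finally show ?thesis .
qed

text \<open>
  The image is generated by the columns of \<open>e\<close>. To lift \<open>f\<close> along the surjection \<open>g\<close>, choose a
  preimage \<open>y\<^sub>j\<close> of the value of \<open>f\<close> at column \<open>j\<close> and send \<open>v\<close> to \<open>\<Sum>j. v\<^sub>j y\<^sub>j\<close>. This lifts
  \<open>f\<close> because \<open>v = e v\<close> is the combination of the columns with the coefficients \<open>v\<^sub>j\<close>.
\<close>

lemma projective_image: "projective_module class_ring M"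
  unfolding projective_module_def
proof (intro conjI module_image allI impI)
  fix A B :: "('a, 'a vec) module" and g f
  assume modA: "module class_ring A" and modB: "module class_ring B"
    and g: "g \<in> module_hom class_ring A B" and surj: "g ` carrier A = carrier B"
    and f: "f \<in> module_hom class_ring M B"
  note monA = abelian_monoid_if_module[OF modA]
  have "\<forall>j\<in>{..<n}. \<exists>y\<in>carrier A. g y = f (col e j)"
  proof
    fix j assume "j \<in> {..<n}"
    then have "f (col e j) \<in> carrier B"
      using module_hom_closed[OF f] col_mem_image by (auto simp: image_simps)
    with surj show "\<exists>y\<in>carrier A. g y = f (col e j)" by (metis imageE)
  qed
  then obtain y where y: "\<And>j. j < n \<Longrightarrow> y j \<in> carrier A" "\<And>j. j < n \<Longrightarrow> g (y j) = f (col e j)"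
    by (metis lessThan_iff)
  define l where "l v = finsum A (\<lambda>j. v $ j \<odot>\<^bsub>A\<^esub> y j) {..<n}" for v
  have yc: "c \<odot>\<^bsub>A\<^esub> y j \<in> carrier A" if "j < n" for c j
    using module.smult_closed[OF modA, of c "y j"] y(1)[OF that] by simp
  have "l \<in> module_hom class_ring M A"
    unfolding module_hom_def mem_Collect_eq
  proof (intro conjI allI impI Pi_I)
    show "l v \<in> carrier A" for v unfolding l_def by (rule abelian_monoid.finsum_closed[OF monA]) (auto simp: yc)
  next
    fix v w assume "v \<in> carrier M \<and> w \<in> carrier M"
    then have vw: "v \<in> carrier_vec n" "w \<in> carrier_vec n" by (auto simp: image_simps)
    have "l (v + w) = finsum A (\<lambda>j. (v $ j \<odot>\<^bsub>A\<^esub> y j) \<oplus>\<^bsub>A\<^esub> (w $ j \<odot>\<^bsub>A\<^esub> y j)) {..<n}"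
      unfolding l_def
      by (rule abelian_monoid.finsum_cong'[OF monA])
        (use vw y(1) yc in
          \<open>auto simp: module.smult_l_distr[OF modA, simplified] abelian_monoid.a_closed[OF monA]\<close>)
    also have "\<dots> = l v \<oplus>\<^bsub>A\<^esub> l w"
      unfolding l_def by (rule abelian_monoid.finsum_addf[OF monA]) (auto simp: yc)
    finally show "l (v \<oplus>\<^bsub>M\<^esub> w) = l v \<oplus>\<^bsub>A\<^esub> l w" by (simp add: image_simps)
  next
    fix c v assume "c \<in> carrier (class_ring :: 'a ring) \<and> v \<in> carrier M"
    then have v: "v \<in> carrier_vec n" by (auto simp: image_simps)
    have "l (c \<cdot>\<^sub>v v) = finsum A (\<lambda>j. c \<odot>\<^bsub>A\<^esub> (v $ j \<odot>\<^bsub>A\<^esub> y j)) {..<n}"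
      unfolding l_def
      by (rule abelian_monoid.finsum_cong'[OF monA])
        (use v y(1) yc module.smult_closed[OF modA, simplified]
          in \<open>auto simp: module.smult_assoc1[OF modA, simplified]\<close>)
    also have "\<dots> = c \<odot>\<^bsub>A\<^esub> l v"
      unfolding l_def by (rule module.finsum_smult_ldistr[OF modA, symmetric]) (auto simp: yc)
    finally show "l (c \<odot>\<^bsub>M\<^esub> v) = c \<odot>\<^bsub>A\<^esub> l v" by (simp add: image_simps)
  qed
  moreover have "g (l v) = f v" if "v \<in> carrier M" for v
  proof -
    from that have v: "v \<in> carrier_vec n" and ev: "e *\<^sub>v v = v" by (auto simp: image_simps)
    have memM: "v $ j \<cdot>\<^sub>v col e j \<in> carrier M" if "j < n" for j
      using module.smult_closed[OF module_image, of "v $ j" "col e j"] col_mem_image[OF that] by (simp add: image_simps)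
    have "g (l v) = finsum B (\<lambda>j. g (v $ j \<odot>\<^bsub>A\<^esub> y j)) {..<n}"
      unfolding l_def by (rule module_hom_finsum[OF modA modB g]) (auto simp: yc)
    also have "\<dots> = finsum B (\<lambda>j. f (v $ j \<cdot>\<^sub>v col e j)) {..<n}"
    proof (rule abelian_monoid.finsum_cong'[OF abelian_monoid_if_module[OF modB]])
      show "(\<lambda>j. f (v $ j \<cdot>\<^sub>v col e j)) \<in> {..<n} \<rightarrow> carrier B"
        using memM module_hom_closed[OF f] by auto
      fix j assume "j \<in> {..<n}"
      then have j: "j < n" by simp
      show "g (v $ j \<odot>\<^bsub>A\<^esub> y j) = f (v $ j \<cdot>\<^sub>v col e j)"
        using module_hom_smult[OF g, of "v $ j" "y j"] module_hom_smult[OF f, of "v $ j" "col e j"]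
          y[OF j] col_mem_image[OF j] by (simp add: image_simps)
    qed simp
    also have "\<dots> = f (finsum M (\<lambda>j. v $ j \<cdot>\<^sub>v col e j) {..<n})"
      by (rule module_hom_finsum[OF module_image modB f, symmetric]) (auto simp: memM)
    also have "\<dots> = f v" by (simp add: finsum_cols[OF v] ev)
    finally show ?thesis .
  qed
  ultimately show "\<exists>l\<in>module_hom class_ring M A. \<forall>x\<in>carrier M. g (l x) = f x" by blast
qed

end

text \<open>
  Freeness of the image, in matrix form: the columns of \<open>P\<close> are a basis of the image of \<open>e\<close>, and
  \<open>Q\<close> gives the coordinates of \<open>e v\<close> in it.
\<close>

lemma idempotent_splits:
  fixes e :: "'a :: comm_ring_1 mat"
  assumes pf: "projective_free (class_ring :: 'a ring)"
    and e [simp]: "e \<in> carrier_mat n n" and idem: "e * e = e"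
  obtains k P Q where "P \<in> carrier_mat n k" and "Q \<in> carrier_mat k n"
    and "P * Q = e" and "Q * P = 1\<^sub>m k"
proof -
  let ?M = "image_module n e"
  note V_module = module_class_ring[of n, where 'a = 'a]
  define N where "N = {v \<in> carrier_vec n. e *\<^sub>v v = v}"
  note span_eq = span_image[OF e idem, folded N_def]
  note sub = submodule_image[OF e idem, folded N_def]
  note [simp] = carrier_matD[OF e]
  have "free_module class_ring ?M"
    using pf finitely_generated_image[OF e idem] projective_image[OF e idem]
    by (auto simp: projective_free_def)
  then obtain B where B: "B \<subseteq> N" "\<not> vec_lin_dep n B" "vec_span n B = N"
    unfolding free_module_def using span_eq by (auto simp: image_simps[OF e idem, folded N_def])
  have "\<exists>A. finite A \<and> A \<subseteq> B \<and> col e j \<in> vec_span n A" if "j < n" for j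
  proof -
    have "col e j \<in> vec_span n B"
      using col_mem_image[OF e idem that] B(3) by (simp add: N_def)
    then show ?thesis unfolding vec_span_iff by blast
  qed
  then obtain A where A: "\<And>j. j < n \<Longrightarrow> finite (A j) \<and> A j \<subseteq> B \<and> col e j \<in> vec_span n (A j)"
    by metis
  \<comment> \<open>The given basis may a priori be infinite; finitely many of its elements already span the columns.\<close>
  define F where "F = (\<Union>j<n. A j)"
  have F: "finite F" "F \<subseteq> B" using A by (auto simp: F_def)
  have FN: "F \<subseteq> N" using F B by auto
  have F_carrier: "F \<subseteq> carrier_vec n" using FN by (auto simp: N_def)
  have F_indpt: "a v = 0" if "vec_lincomb n a F = 0\<^sub>v n" "v \<in> F" for a v
    using that B(2) F unfolding vec_lin_dep_iff by blast
  obtain bs where bs: "set bs = F" "distinct bs"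
    using finite_distinct_list[OF F(1)] by auto
  define k where "k = length bs"
  define P where "P = mat_of_cols n bs"
  have P: "P \<in> carrier_mat n k" by (simp add: P_def k_def)
  have bs_F: "bs ! i \<in> F" if "i < k" for i
    using that bs(1) nth_mem unfolding k_def by blast
  have bs_mem: "bs ! i \<in> N" if "i < k" for i
    using bs_F[OF that] FN by blast
  have bs_carrier: "bs ! i \<in> carrier_vec n" if "i < k" for i
    using bs_mem[OF that] by (simp add: N_def)
  have P_vec: "P *\<^sub>v w = vec_lincomb n a F"
    if w: "w \<in> carrier_vec k" and aw: "\<And>i. i < k \<Longrightarrow> a (bs ! i) = w $ i" for a w
  proof -
    have "P *\<^sub>v w = vec_lincomb n (\<lambda>b. \<Sum>i = 0..<length bs. if b = bs ! i then w $ i else 0) (set bs)"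
      unfolding P_def
      by (rule vec_module.mat_of_cols_mult_as_finsum) (use w bs_carrier in \<open>auto simp: k_def\<close>)
    also have "\<dots> = vec_lincomb n a F"
    proof (rule module.lincomb_cong[OF module_class_ring])
      fix b assume "b \<in> set bs"
      then obtain i where i: "i < k" "b = bs ! i" by (auto simp: in_set_conv_nth k_def)
      have "(\<Sum>j = 0..<length bs. if b = bs ! j then w $ j else 0)
          = (\<Sum>j = 0..<length bs. if j = i then w $ j else 0)"
        using i bs(2) by (intro sum.cong refl) (auto simp: nth_eq_iff_index_eq k_def)
      then show "(\<Sum>j = 0..<length bs. if b = bs ! j then w $ j else 0) = a b"
        using i aw by (simp add: k_def)
    qed (use bs F_carrier in \<open>auto simp: module_vec_simps\<close>)
    finally show ?thesis .
  qed
  have "\<exists>a. vec_lincomb n a F = col e j" if j: "j < n" for j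
  proof -
    have "A j \<subseteq> F" using j by (auto simp: F_def)
    then have "col e j \<in> vec_span n F"
      using module.span_is_monotone[OF module_class_ring] A[OF j] by blast
    then show ?thesis
      using module.finite_in_span[OF module_class_ring F(1), of n "col e j"] F_carrier
      by (auto simp: module_vec_simps)
  qed
  then obtain a where a: "\<And>j. j < n \<Longrightarrow> vec_lincomb n (a j) F = col e j" by metis
  define Q where "Q = mat k n (\<lambda>(i, j). a j (bs ! i))"
  have Q: "Q \<in> carrier_mat k n" by (simp add: Q_def)
  have PQ: "P * Q = e"
  proof (rule mat_eq_by_unit_vecs[of _ n n])
    fix j assume j: "j < n"
    have "(P * Q) *\<^sub>v unit_vec n j = P *\<^sub>v (Q *\<^sub>v unit_vec n j)"
      by (rule assoc_mult_mat_vec[OF P Q]) simp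
    also have "\<dots> = col e j"
    proof (subst P_vec[of _ "a j"])
      show "Q *\<^sub>v unit_vec n j \<in> carrier_vec k" using Q by simp
    qed (use j in \<open>auto simp: a Q_def\<close>)
    finally show "(P * Q) *\<^sub>v unit_vec n j = e *\<^sub>v unit_vec n j"
      by (simp add: mult_unit_vec[OF e idem j])
  qed (use P Q in auto)
  have eP: "e * P = P"
  proof (rule mat_eq_by_unit_vecs[of _ n k])
    fix i assume i: "i < k"
    have "P *\<^sub>v unit_vec k i = bs ! i"
    proof (rule eq_vecI)
      fix r assume "r < dim_vec (bs ! i)"
      then show "(P *\<^sub>v unit_vec k i) $ r = bs ! i $ r"
        using i bs_carrier[OF i] by (simp add: P_def mat_of_cols_index k_def)
    qed (use bs_carrier[OF i] P in simp)
    then show "(e * P) *\<^sub>v unit_vec k i = P *\<^sub>v unit_vec k i"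
      using bs_mem[OF i] assoc_mult_mat_vec[OF e P, of "unit_vec k i"] by (simp add: N_def)
  qed (fact mult_carrier_mat[OF e P], fact P)
  have "Q * P = 1\<^sub>m k"
  proof (rule mat_eq_by_unit_vecs[of _ k k])
    fix i assume i: "i < k"
    \<comment> \<open>Since \<open>P (Q P) = e P = P\<close>, the entries of \<open>w\<close> form a relation between basis elements.\<close>
    define w where "w = (Q * P) *\<^sub>v unit_vec k i - unit_vec k i"
    have w: "w \<in> carrier_vec k"
      unfolding w_def by (rule minus_carrier_vec) (use mult_carrier_mat[OF Q P] in simp_all)
    have "P *\<^sub>v w = P *\<^sub>v ((Q * P) *\<^sub>v unit_vec k i) - P *\<^sub>v unit_vec k i"
      unfolding w_def using P Q by (intro mult_minus_distrib_mat_vec) auto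
    also have "P *\<^sub>v ((Q * P) *\<^sub>v unit_vec k i) = (P * (Q * P)) *\<^sub>v unit_vec k i"
      using P Q by (intro assoc_mult_mat_vec[symmetric]) auto
    also have "P * (Q * P) = P"
      using assoc_mult_mat[OF P Q P] PQ eP by simp
    finally have Pw: "P *\<^sub>v w = 0\<^sub>v n"
      using minus_cancel_vec[OF mult_mat_vec_carrier[OF P unit_vec_carrier]] by simp
    define c where "c b = w $ (THE j. j < k \<and> bs ! j = b)" for b
    have c: "c (bs ! j) = w $ j" if "j < k" for j
    proof -
      have "(THE j'. j' < k \<and> bs ! j' = bs ! j) = j"
        by (rule the_equality) (use that bs(2) in \<open>auto simp: k_def nth_eq_iff_index_eq\<close>)
      then show ?thesis by (simp add: c_def)
    qed
    have "vec_lincomb n c F = 0\<^sub>v n" using P_vec[OF w c] Pw by simp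
    then have w0: "w $ j = 0" if "j < k" for j
      using F_indpt[of c "bs ! j"] c[OF that] bs_F[OF that] by simp
    show "(Q * P) *\<^sub>v unit_vec k i = 1\<^sub>m k *\<^sub>v unit_vec k i"
    proof (rule eq_vecI)
      fix j assume "j < dim_vec (1\<^sub>m k *\<^sub>v unit_vec k i)"
      then have j: "j < k" by simp
      have "w $ j = ((Q * P) *\<^sub>v unit_vec k i) $ j - unit_vec k i $ j"
        unfolding w_def by (rule index_minus_vec) (use j in simp)
      then show "((Q * P) *\<^sub>v unit_vec k i) $ j = (1\<^sub>m k *\<^sub>v unit_vec k i) $ j"
        using w0[OF j] by simp
    qed (use Q in simp)
  qed (use P Q in auto)
  with P Q PQ show ?thesis by (rule that)
qed

section \<open>Strong cleanness and comaximal factorizations\<close>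

text \<open>
  Modulo \<open>h0 h1\<close>, the elements \<open>h0 u\<close> and \<open>h1 v\<close> are complementary idempotents. On the part cut out
  by \<open>h0 u\<close> the element \<open>x - h0 u\<close> is \<open>x - 1\<close>, which has the inverse \<open>- c1 q1\<close> because \<open>h1\<close>
  vanishes there; on the other part it is \<open>x\<close>, with inverse \<open>- c0 q0\<close>.
\<close>

lemma comaximal_factors_give_inverse:
  fixes h0 h1 u v c0 c1 a0 a1 q0 q1 x :: "'a :: comm_ring_1"
  assumes uv: "h0 * u + h1 * v = 1"
    and h0: "h0 = a0 + x * q0" and h1: "h1 = a1 + (x - 1) * q1"
    and c0: "a0 * c0 = 1" and c1: "a1 * c1 = 1"
  shows "h0 * h1 dvd (x - h0 * u) * (- (c1 * q1 * (h0 * u)) - c0 * q0 * (h1 * v)) - 1"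
proof
  define p where "p = h0 * u"
  define e where "e = h1 * v"
  define d where "d = c0 * (x - 1) * q0 + c1 * x * q1"
  define s where "s = c1 * p * u + c0 * e * v + u * v * (2 + d)"
  have pe: "p + e = 1" using uv by (simp add: p_def e_def)
  have "x - p = x * (p + e) - p" by (simp add: pe)
  then have x_p: "x - p = (x - 1) * p + x * e" by (simp add: algebra_simps)
  have k0: "c0 * (x * q0) = c0 * h0 - 1" and k1: "c1 * ((x - 1) * q1) = c1 * h1 - 1"
    using c0 c1 by (simp_all add: h0 h1 distrib_left mult.commute)
  have "(x - p) * (- (c1 * q1 * p) - c0 * q0 * e)
      = - (c1 * ((x - 1) * q1)) * (p * p) - c0 * (x * q0) * (e * e) - p * e * d"
    unfolding x_p d_def by (simp add: algebra_simps)
  also have "\<dots> = (p + e) * (p + e) - (c1 * h1 * (p * p) + c0 * h0 * (e * e) + p * e * (2 + d))"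
    unfolding k0 k1 by (simp add: algebra_simps)
  also have "\<dots> = 1 - (c1 * h1 * (p * p) + c0 * h0 * (e * e) + p * e * (2 + d))"
    by (simp add: pe)
  also have "c1 * h1 * (p * p) + c0 * h0 * (e * e) + p * e * (2 + d) = h0 * h1 * s"
    by (simp add: p_def e_def s_def algebra_simps)
  finally show "(x - h0 * u) * (- (c1 * q1 * (h0 * u)) - c0 * q0 * (h1 * v)) - 1 = h0 * h1 * (- s)"
    unfolding p_def[symmetric] e_def[symmetric] by simp
qed

lemma poly_mat_eq_if_dvd_diff:
  assumes A: "A \<in> carrier_mat n n" and "char_poly A dvd p - q"
  shows "poly_mat A p = poly_mat A q"
proof -
  have "poly_mat A ((p - q) + q) = 0\<^sub>m n n + poly_mat A q"
    unfolding poly_mat_add[OF A]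
    using poly_mat_dvd_eq_0[OF A assms(2) cayley_hamilton[OF A]] by simp
  then show ?thesis using poly_mat_carrier[OF A] by simp
qed

lemma strongly_clean_mat_iff:
  "strongly_clean (ring_mat TYPE('a :: comm_ring_1) n ()) A \<longleftrightarrow>
    (\<exists>e u w. e \<in> carrier_mat n n \<and> u \<in> carrier_mat n n \<and> w \<in> carrier_mat n n \<and>
      w * u = 1\<^sub>m n \<and> u * w = 1\<^sub>m n \<and> e * e = e \<and> A = e + u \<and> e * u = u * e)"
  unfolding strongly_clean_def Units_def ring_mat_simps by blast

text \<open>
  The idempotent is \<open>(h0 u)(A)\<close>, where \<open>h0 u + h1 v = 1\<close>. All matrices involved are polynomials in
  \<open>A\<close>, so by Cayley--Hamilton the required identities need only hold modulo \<open>h0 h1\<close>.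
\<close>

lemma strongly_clean_if_char_poly_factors:
  fixes A :: "'a :: comm_ring_1 mat"
  assumes A: "A \<in> carrier_mat n n" and fact: "char_poly A = h0 * h1"
    and "h0 \<in> \<S> 0" and "h1 \<in> \<S> 1" and "comaximal h0 h1"
  shows "strongly_clean (ring_mat TYPE('a) n ()) A"
proof -
  from assms obtain u v where uv: "h0 * u + h1 * v = 1" by (auto simp: comaximal_def)
  obtain q0 where q0: "h0 = [:poly h0 0:] + [:- 0, 1:] * q0"
    by (rule poly_eq_value_plus_linear_multiple)
  obtain q1 where q1: "h1 = [:poly h1 1:] + [:- 1, 1:] * q1"
    by (rule poly_eq_value_plus_linear_multiple)
  have "poly h0 0 dvd 1" and "poly h1 1 dvd 1"
    using assms(3,4) by (simp_all add: monic_unit_at_def)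
  then obtain c0 c1 where c: "poly h0 0 * c0 = 1" "poly h1 1 * c1 = 1"
    by (metis dvdE)
  define X :: "'a poly" where "X = [:0, 1:]"
  define p where "p = h0 * u"
  define w where "w = - ([:c1:] * q1 * (h0 * u)) - [:c0:] * q0 * (h1 * v)"
  have "h0 * h1 dvd (X - p) * w - 1"
    unfolding p_def w_def
  proof (rule comaximal_factors_give_inverse[OF uv])
    have X: "[:- 0, 1:] = X" "[:- 1, 1:] = X - 1" by (simp_all add: X_def one_pCons)
    show "h0 = [:poly h0 0:] + X * q0" by (rule q0[unfolded X])
    show "h1 = [:poly h1 1:] + (X - 1) * q1" by (rule q1[unfolded X])
    show "[:poly h0 0:] * [:c0:] = 1" "[:poly h1 1:] * [:c1:] = 1"
      using c by (simp_all add: one_pCons mult.commute)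
  qed
  then have "poly_mat A ((X - p) * w) = poly_mat A 1"
    by (intro poly_mat_eq_if_dvd_diff[OF A]) (simp only: fact)
  then have inv: "poly_mat A ((X - p) * w) = 1\<^sub>m n"
    by (simp only: poly_mat_1[OF A])
  have "p * p - p = - (p * (1 - p))" by (simp add: algebra_simps)
  also have "1 - p = h1 * v" unfolding p_def uv[symmetric] by simp
  finally have "p * p - p = h0 * h1 * (- (u * v))" by (simp add: p_def ac_simps)
  then have idem: "poly_mat A (p * p) = poly_mat A p"
    by (intro poly_mat_eq_if_dvd_diff[OF A]) (simp only: fact dvd_triv_left)
  have sum: "A = poly_mat A p + poly_mat A (X - p)"
    unfolding poly_mat_add[OF A, symmetric] by (simp add: X_def poly_mat_X[OF A])
  note pm = poly_mat_carrier[OF A] poly_mat_mult[OF A, symmetric]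
  show ?thesis
    unfolding strongly_clean_mat_iff
  proof (rule exI[of _ "poly_mat A p"], rule exI[of _ "poly_mat A (X - p)"],
      rule exI[of _ "poly_mat A w"], intro conjI)
    show "poly_mat A w * poly_mat A (X - p) = 1\<^sub>m n"
      and "poly_mat A (X - p) * poly_mat A w = 1\<^sub>m n"
      using inv by (simp_all only: pm mult.commute)
    show "poly_mat A p * poly_mat A p = poly_mat A p"
      using idem by (simp only: pm)
    show "poly_mat A p * poly_mat A (X - p) = poly_mat A (X - p) * poly_mat A p"
      by (simp only: pm mult.commute)
  qed (rule pm(1) sum)+
qed

text \<open>
  If \<open>R B\<close> and \<open>R' B'\<close> are orthogonal idempotents, then the coordinate map \<open>B\<close> of the first image
  kills the basis \<open>R'\<close> of the second.
\<close>

lemma orthogonal_if_idempotents_orthogonal: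
  fixes R :: "'a :: comm_ring_1 mat"
  assumes R: "R \<in> carrier_mat n a" and B: "B \<in> carrier_mat a n" and R': "R' \<in> carrier_mat n b"
    and B': "B' \<in> carrier_mat b n" and BR: "B * R = 1\<^sub>m a" and BR': "B' * R' = 1\<^sub>m b"
    and zero: "(R * B) * (R' * B') = 0\<^sub>m n n"
  shows "B * R' = 0\<^sub>m a b"
proof -
  have E: "R * B \<in> carrier_mat n n" and F: "R' * B' \<in> carrier_mat n n"
    using R B R' B' by simp_all
  have "B * (R * B) = B"
    using assoc_mult_mat[OF B R B] BR B by simp
  moreover have "(R' * B') * R' = R'"
    using assoc_mult_mat[OF R' B' R'] BR' R' by simp
  ultimately have "B * R' = (B * (R * B)) * ((R' * B') * R')" by simp
  also have "\<dots> = B * ((R * B) * ((R' * B') * R'))"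
    by (rule assoc_mult_mat[OF B E mult_carrier_mat[OF F R']])
  also have "(R * B) * ((R' * B') * R') = ((R * B) * (R' * B')) * R'"
    by (rule assoc_mult_mat[OF E F R', symmetric])
  finally show ?thesis
    unfolding zero left_mult_zero_mat[OF R'] right_mult_zero_mat[OF B] .
qed

text \<open>
  A strongly clean matrix \<open>A = e + u\<close> splits \<open>R\<^sup>n\<close> into the images of \<open>e\<close> and \<open>f = 1 - e\<close>: on the
  former \<open>A - 1\<close> acts as the unit \<open>u\<close>, on the latter \<open>A\<close> does.
\<close>

lemma strongly_clean_mat_splits:
  fixes A :: "'a :: comm_ring_1 mat"
  assumes A: "A \<in> carrier_mat n n" and "strongly_clean (ring_mat TYPE('a) n ()) A"
  obtains e f w where "e \<in> carrier_mat n n" and "f \<in> carrier_mat n n" and "w \<in> carrier_mat n n"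
    and "e * e = e" and "f * f = f" and "e + f = 1\<^sub>m n" and "e * f = 0\<^sub>m n n" and "f * e = 0\<^sub>m n n"
    and "A * e = e * A" and "A * f = f * A"
    and "w * ((1 \<cdot>\<^sub>m 1\<^sub>m n - A) * e) = e" and "w * ((0 \<cdot>\<^sub>m 1\<^sub>m n - A) * f) = f"
proof -
  from assms obtain e u w where e: "e \<in> carrier_mat n n" and u: "u \<in> carrier_mat n n"
    and w: "w \<in> carrier_mat n n" and wu: "w * u = 1\<^sub>m n" and ee: "e * e = e"
    and Aeu: "A = e + u" and eu: "e * u = u * e"
    unfolding strongly_clean_mat_iff by blast
  note one = one_carrier_mat[of n, where 'a = 'a]
  note dims = carrier_matD[OF e] carrier_matD[OF u] carrier_matD[OF w] carrier_matD[OF A]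
  define f where "f = 1\<^sub>m n - e"
  have f: "f \<in> carrier_mat n n" unfolding f_def by (rule minus_carrier_mat[OF e])
  have ef_sum: "e + f = 1\<^sub>m n"
    unfolding f_def by (rule eq_matI) (simp_all add: carrier_matD[OF e])
  have ef: "e * f = 0\<^sub>m n n"
    unfolding f_def mult_minus_distrib_mat[OF e one e] right_mult_one_mat[OF e] ee
    by (rule minus_r_inv_mat[OF e])
  have fe: "f * e = 0\<^sub>m n n"
    unfolding f_def minus_mult_distrib_mat[OF one e e] left_mult_one_mat[OF e] ee
    by (rule minus_r_inv_mat[OF e])
  have ff: "f * f = f"
    using add_mult_distrib_mat[OF e f f] unfolding ef ef_sum
    unfolding left_mult_one_mat[OF f] left_add_zero_mat[OF mult_carrier_mat[OF f f]] by (rule sym)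
  have Ae: "A * e = e + u * e"
    unfolding Aeu add_mult_distrib_mat[OF e u e] ee ..
  have eA: "e * A = e + u * e"
    unfolding Aeu mult_add_distrib_mat[OF e e u] ee eu ..
  have Af: "A * f = u * f"
    unfolding Aeu add_mult_distrib_mat[OF e u f] ef
    by (rule left_add_zero_mat[OF mult_carrier_mat[OF u f]])
  have comm_f: "A * f = f * A"
    unfolding f_def mult_minus_distrib_mat[OF A one e] minus_mult_distrib_mat[OF one e A]
      left_mult_one_mat[OF A] right_mult_one_mat[OF A] Ae eA ..
  have wug: "(- w) * (- (u * g)) = g" if g: "g \<in> carrier_mat n n" for g
  proof -
    have "(- w) * (- (u * g)) = w * (u * g)" using g dims by simp
    also have "\<dots> = (w * u) * g" by (rule assoc_mult_mat[OF w u g, symmetric])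
    also have "\<dots> = g" unfolding wu by (rule left_mult_one_mat[OF g])
    finally show ?thesis .
  qed
  have "1 \<cdot>\<^sub>m 1\<^sub>m n = (1\<^sub>m n :: 'a mat)" by (rule eq_matI) simp_all
  then have "(1 \<cdot>\<^sub>m 1\<^sub>m n - A) * e = e - (e + u * e)"
    by (simp only: minus_mult_distrib_mat[OF one A e] left_mult_one_mat[OF e] Ae)
  also have "\<dots> = - (u * e)"
    by (rule eq_matI) (simp_all add: dims)
  finally have inv_e: "(- w) * ((1 \<cdot>\<^sub>m 1\<^sub>m n - A) * e) = e" using wug[OF e] by simp
  have "0 \<cdot>\<^sub>m 1\<^sub>m n - A = - A" by (rule eq_matI) (simp_all add: dims)
  then have "(0 \<cdot>\<^sub>m 1\<^sub>m n - A) * f = - (u * f)"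
    using uminus_mult_left_mat[of A f] Af carrier_matD[OF f] dims by simp
  then have inv_f: "(- w) * ((0 \<cdot>\<^sub>m 1\<^sub>m n - A) * f) = f" using wug[OF f] by simp
  have "- w \<in> carrier_mat n n" using w by simp
  moreover have "A * e = e * A" unfolding Ae eA ..
  ultimately show ?thesis
    using that e f ee ff ef_sum ef fe comm_f inv_e inv_f by blast
qed

lemma factorization_if_companion_strongly_clean:
  fixes h :: "'a :: comm_ring_1 poly"
  assumes pf: "projective_free (class_ring :: 'a ring)"
    and h: "monic h" "degree h = n" and n: "n \<ge> 1"
    and clean: "strongly_clean (ring_mat TYPE('a) n ()) (companion_matrix h)"
  shows "\<exists>h0 h1. h = h0 * h1 \<and> h0 \<in> \<S> 0 \<and> h1 \<in> \<S> 1 \<and> comaximal h0 h1"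
proof -
  let ?C = "companion_matrix h"
  note C = companion_carrier[OF h n]
  obtain e f w where e: "e \<in> carrier_mat n n" and f: "f \<in> carrier_mat n n"
    and w: "w \<in> carrier_mat n n" and ee: "e * e = e" and ff: "f * f = f"
    and ef_sum: "e + f = 1\<^sub>m n" and ef: "e * f = 0\<^sub>m n n" and fe: "f * e = 0\<^sub>m n n"
    and comm_e: "?C * e = e * ?C" and comm_f: "?C * f = f * ?C"
    and inv_e: "w * ((1 \<cdot>\<^sub>m 1\<^sub>m n - ?C) * e) = e" and inv_f: "w * ((0 \<cdot>\<^sub>m 1\<^sub>m n - ?C) * f) = f"
    by (rule strongly_clean_mat_splits[OF C clean])
  obtain k P Q where P: "P \<in> carrier_mat n k" and Q: "Q \<in> carrier_mat k n"
    and PQ: "P * Q = e" and QP: "Q * P = 1\<^sub>m k"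
    by (rule idempotent_splits[OF pf e ee])
  obtain l P' Q' where P': "P' \<in> carrier_mat n l" and Q': "Q' \<in> carrier_mat l n"
    and PQ': "P' * Q' = f" and QP': "Q' * P' = 1\<^sub>m l"
    by (rule idempotent_splits[OF pf f ff])
  obtain h1 where h1: "monic h1" "degree h1 = k" "poly h1 1 dvd 1" "poly_mat ?C h1 * e = 0\<^sub>m n n"
    by (rule char_poly_of_free_summand[OF C P Q w QP, of 1, unfolded PQ, OF comm_e inv_e])
  obtain h0 where h0: "monic h0" "degree h0 = l" "poly h0 0 dvd 1" "poly_mat ?C h0 * f = 0\<^sub>m n n"
    by (rule char_poly_of_free_summand[OF C P' Q' w QP', of 0, unfolded PQ', OF comm_f inv_f])
  have "k + l \<le> n"
    by (rule rank_sum_le_if_block_left_inverse[OF P P' Q Q' QP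
          orthogonal_if_idempotents_orthogonal[OF P Q P' Q' QP QP']
          orthogonal_if_idempotents_orthogonal[OF P' Q' P Q QP' QP] QP'])
      (simp_all only: PQ PQ' ef fe)
  note pm = poly_mat_carrier[OF C] poly_mat_mult[OF C]
  note h_dvd = poly_mat_companion_eq_0_iff[OF h n]
  have h01_monic: "monic (h0 * h1)"
    using degree_monic_mult[OF h0(1), of h1] lcoeff_monic_mult[OF h0(1), of h1] h1(1)
    by (cases "h1 = 0") auto
  \<comment> \<open>\<open>h1(C)\<close> kills the image of \<open>e\<close> and \<open>h0(C)\<close> that of \<open>f\<close>, so their product is \<open>0\<close>.\<close>
  have "poly_mat ?C (h0 * h1) = poly_mat ?C (h0 * h1) * (e + f)"
    unfolding ef_sum right_mult_one_mat[OF pm(1)] ..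
  also have "\<dots> = poly_mat ?C (h0 * h1) * e + poly_mat ?C (h1 * h0) * f"
    unfolding mult.commute[of h1 h0] by (rule mult_add_distrib_mat[OF pm(1) e f])
  also have "poly_mat ?C (h0 * h1) * e = poly_mat ?C h0 * (poly_mat ?C h1 * e)"
    unfolding pm(2) by (rule assoc_mult_mat[OF pm(1) pm(1) e])
  also have "poly_mat ?C (h1 * h0) * f = poly_mat ?C h1 * (poly_mat ?C h0 * f)"
    unfolding pm(2) by (rule assoc_mult_mat[OF pm(1) pm(1) f])
  finally have "poly_mat ?C (h0 * h1) = 0\<^sub>m n n"
    unfolding h0(4) h1(4) right_mult_zero_mat[OF pm(1)] by simp
  then have "h dvd h0 * h1" by (simp add: h_dvd)
  moreover have "degree (h0 * h1) \<le> degree h"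
    using degree_mult_le[of h0 h1] h0(2) h1(2) \<open>k + l \<le> n\<close> h(2) by simp
  ultimately have fact: "h = h0 * h1"
    using monic_dvd_imp_eq[OF h(1) h01_monic] by simp
  \<comment> \<open>Comaximality comes from writing the idempotent as a polynomial in \<open>C\<close>.\<close>
  obtain p where p: "e = poly_mat ?C p"
    by (rule commute_companion_obtains_poly[OF h n e comm_e])
  have sum: "e + poly_mat ?C (1 - p) = 1\<^sub>m n"
    unfolding p poly_mat_add[OF C, symmetric] by (simp add: poly_mat_1[OF C])
  have "f = (e + f) - e"
    by (rule eq_matI) (simp_all add: carrier_matD[OF e] carrier_matD[OF f])
  also have "\<dots> = (e + poly_mat ?C (1 - p)) - e" unfolding ef_sum sum ..
  also have "\<dots> = poly_mat ?C (1 - p)"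
    by (rule eq_matI) (simp_all add: carrier_matD[OF e] carrier_matD[OF pm(1)])
  finally have p': "f = poly_mat ?C (1 - p)" .
  have "h dvd h1 * p" and "h dvd h0 * (1 - p)"
    unfolding h_dvd[symmetric] pm(2) p[symmetric] p'[symmetric] by (fact h1(4), fact h0(4))
  then obtain a b where "h1 * p = h * a" and "h0 * (1 - p) = h * b"
    by (auto elim!: dvdE)
  then have "h1 * p = h1 * (h0 * a)" and "h0 * (1 - p) = h0 * (h1 * b)"
    by (simp_all only: fact ac_simps)
  then have pa: "p = h0 * a" and pb: "1 - p = h1 * b"
    using monic_mult_left_cancel[OF h1(1)] monic_mult_left_cancel[OF h0(1)] by blast+
  have "h0 * a + h1 * b = 1" unfolding pa[symmetric] pb[symmetric] by simp
  then have "comaximal h0 h1" unfolding comaximal_def by blast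
  moreover have "h0 \<in> \<S> 0" and "h1 \<in> \<S> 1"
    using h0(1,3) h1(1,3) by (simp_all add: monic_unit_at_def)
  ultimately show ?thesis using fact by blast
qed

theorem theorem2p4:
  fixes h :: "'a :: comm_ring_1 poly" and n :: nat
  assumes "projective_free (class_ring :: 'a ring)"
    and "n \<ge> 1"
    and "monic h"
    and "degree h = n"
  shows "((\<forall>\<phi> \<in> carrier_mat n n.
             char_poly \<phi> = h \<longrightarrow> strongly_clean (ring_mat TYPE('a) n ()) \<phi>)
          \<longleftrightarrow> strongly_clean (ring_mat TYPE('a) n ()) (companion_matrix h))
       \<and> (strongly_clean (ring_mat TYPE('a) n ()) (companion_matrix h)
          \<longleftrightarrow> (\<exists>h0 h1. h = h0 * h1 \<and> h0 \<in> \<S> 0 \<and> h1 \<in> \<S> 1 \<and> comaximal h0 h1))"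
    (is "(?all \<longleftrightarrow> ?comp) \<and> (_ \<longleftrightarrow> ?factors)")
proof -
  have "?all \<Longrightarrow> ?comp"
    using companion_carrier[OF assms(3,4,2)] char_poly_companion[OF assms(3,4,2)] by blast
  moreover have "?comp \<Longrightarrow> ?factors"
    by (rule factorization_if_companion_strongly_clean[OF assms(1,3,4,2)])
  moreover have "?factors \<Longrightarrow> ?all"
  proof (intro ballI impI)
    fix \<phi> assume "?factors" "\<phi> \<in> carrier_mat n n" "char_poly \<phi> = h"
    then obtain h0 h1 where "char_poly \<phi> = h0 * h1" "h0 \<in> \<S> 0" "h1 \<in> \<S> 1" "comaximal h0 h1"
      by metis
    then show "strongly_clean (ring_mat TYPE('a) n ()) \<phi>"
      by (rule strongly_clean_if_char_poly_factors[OF \<open>\<phi> \<in> carrier_mat n n\<close>])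
  qed
  ultimately show ?thesis by blast
qed

end
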